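(* Let $\mathbf X$ be equipped with a partial order $\le_{\mathbf X}$ such that for every $x\in\mathbf X$ the set $\{y\in\mathbf X: x\le_{\mathbf X}y\}$ is $\mathcal B(\mathbf X)$-measurable. Let $F$ be nondecreasing with respect to $\le_{\mathbf X}$ and let the Markov kernel $P$ be stochastically monotone with respect to $\le_{\mathbf X}$, i.e., for every bounded measurable nondecreasing $g:\mathbf X\to\mathbb R$ the map $x\mapsto\int_{\mathbf X}g(y)\,P(dy\mid x)$ is nondecreasing. Suppose that $(PF)(x)\ge F(x)$ for all $x\in\mathbf X$, and let $\gamma\in(0,1]$ be fixed. Then the threshold index $k^\star_\gamma$ is nonincreasing with respect to $\le_{\mathbf X}$: for all $x,x'\in\mathbf X$, $$x\le_{\mathbf X}x'\ \Longrightarrow\ k^\star_\gamma(x)\ge k^\star_\gamma(x').$$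
   Context: Setting. $\mathbf X$ is a Borel space (with Borel $\sigma$-algebra $\mathcal B(\mathbf X)$), $P$ is a stochastic (Markov) kernel on $\mathbf X$ given $\mathbf X$, $\nu$ is a probability measure on $\mathbf X$, $F:\mathbf X\to[0,\infty]$ is measurable, and $G(n),G(r)\in[0,\infty)$ are constants. $\mathbb N_0=\{0,1,2,\dots\}$. $P^k$ is the $k$-fold composition of $P$ ($P^0$ is the identity kernel) and $(P^kF)(x)=\int_{\mathbf X}F(y)P^k(dy\mid x)$. A $[-\infty,\infty]$-valued function $g$ on $\mathbf X$ is nondecreasing if $g(x)\le g(y)$ whenever $x\le_{\mathbf X}y$. The MDP $\{\mathbf S,\mathbf A,Q,c\}$ (the fully observed reduction of the Restart POMDP) has state space $\mathbf S=\mathbf X\times\mathbb N_0$ (last observed state, time elapsed since last restart), action space $\mathbf A=\{n,r\}$ ($n$: no intervention, $r$: restart), transition kernel $Q(dx'\times dk'\mid(x,k),n)=\delta_x(dx')\delta_{k+1}(dk')$, $Q(dx'\times dk'\mid(x,k),r)=\nu(dx')\delta_0(dk')$, and one-step cost $c(x,k;a)=(P^kF)(x)+G(a)$. A policy $\pi=\{\pi_t\}_{t\ge0}$ is a sequence of stochastic kernels $\pi_t$ on $\mathbf A$ given $(\mathbf S\times\mathbf A)^t\times\mathbf S$ (randomized, history-dependent). $\mathsf E^\pi_{x,k}$ is the expectation for the process $\{(S_t,A_t)\}$ of states and actions under $\pi$ started at $(x,k)$. For $\gamma\in(0,1]$, $V^\pi_\gamma(x,k)=\mathsf E^\pi_{x,k}\big[\sum_{t\ge0}\gamma^t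 c(S_t,A_t)\big]\in[0,\infty]$ and $V_\gamma(x,k)=\inf_\pi V^\pi_\gamma(x,k)$. Threshold index: with $V_{0,\gamma}=\int_{\mathbf X}V_\gamma(z,0)\,\nu(dz)$ and $A(\gamma)=G(r)+\gamma V_{0,\gamma}$, $$k^\star_\gamma(x)=\inf\{k\in\mathbb N_0: A(\gamma)\le G(n)+\gamma V_\gamma(x,k+1)\}\in\mathbb N_0\cup\{\infty\},\qquad \inf\emptyset=\infty.$$ *)

theory Defs
  imports "HOL-Probability.Probability"
begin

section \<open>Markov decision processes with randomized history-dependent policies\<close>

text \<open>
  A trajectory is a function \<open>\<omega>\<close> with \<open>\<omega> t = (S\<^sub>t, A\<^sub>t)\<close>.  The history space at time
  \<open>t\<close>, \<open>(S \<times> A)\<^sup>t \<times> S\<close>, is the product of the \<open>{0..<t}\<close>-indexed product space of state-action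
  pairs with the space of the current state.
\<close>

definition policies ::
  "'s measure \<Rightarrow> 'b measure \<Rightarrow> (nat \<Rightarrow> (nat \<Rightarrow> 's \<times> 'b) \<times> 's \<Rightarrow> 'b measure) set" where
  "policies S A =
     {\<pi>. \<forall>t. \<pi> t \<in> (\<Pi>\<^sub>M i\<in>{0..<t}. S \<Otimes>\<^sub>M A) \<Otimes>\<^sub>M S \<rightarrow>\<^sub>M prob_algebra A}"

definition state_kernel ::
  "'s measure \<Rightarrow> ('s \<times> 'b \<Rightarrow> 's measure) \<Rightarrow> 's \<Rightarrow> nat \<Rightarrow> (nat \<Rightarrow> 's \<times> 'b) \<Rightarrow> 's measure" where
  "state_kernel S Q s t h = (case t of 0 \<Rightarrow> return S s | Suc u \<Rightarrow> Q (h u))"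

definition step_kernel ::
  "'s measure \<Rightarrow> 'b measure \<Rightarrow> ('s \<times> 'b \<Rightarrow> 's measure) \<Rightarrow>
   (nat \<Rightarrow> (nat \<Rightarrow> 's \<times> 'b) \<times> 's \<Rightarrow> 'b measure) \<Rightarrow> 's \<Rightarrow>
   nat \<Rightarrow> (nat \<Rightarrow> 's \<times> 'b) \<Rightarrow> ('s \<times> 'b) measure" where
  "step_kernel S A Q \<pi> s t h =
     state_kernel S Q s t h \<bind> (\<lambda>y. return S y \<Otimes>\<^sub>M \<pi> t (h, y))"

text \<open>
  The law of the process is the Ionescu-Tulcea measure of the step kernels (the constant written
  \<open>PF.lim\<close> inside the locale \<^locale>\<open>Ionescu_Tulcea\<close>); the lemma \<open>Ionescu_Tulcea_step_kernel\<close>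
  below shows that the assumptions of that locale hold.
\<close>

definition trajectory_measure ::
  "'s measure \<Rightarrow> 'b measure \<Rightarrow> ('s \<times> 'b \<Rightarrow> 's measure) \<Rightarrow>
   (nat \<Rightarrow> (nat \<Rightarrow> 's \<times> 'b) \<times> 's \<Rightarrow> 'b measure) \<Rightarrow> 's \<Rightarrow> (nat \<Rightarrow> 's \<times> 'b) measure" where
  "trajectory_measure S A Q \<pi> s =
     projective_family.lim UNIV
       (Ionescu_Tulcea.CI (step_kernel S A Q \<pi> s) (\<lambda>_. S \<Otimes>\<^sub>M A)) (\<lambda>_. S \<Otimes>\<^sub>M A)"

definition policy_value ::
  "'s measure \<Rightarrow> 'b measure \<Rightarrow> ('s \<times> 'b \<Rightarrow> 's measure) \<Rightarrow> ('s \<times> 'b \<Rightarrow> ennreal) \<Rightarrow> real \<Rightarrow>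
   (nat \<Rightarrow> (nat \<Rightarrow> 's \<times> 'b) \<times> 's \<Rightarrow> 'b measure) \<Rightarrow> 's \<Rightarrow> ennreal" where
  "policy_value S A Q c \<gamma> \<pi> s =
     (\<integral>\<^sup>+ \<omega>. (\<Sum>t. ennreal \<gamma> ^ t * c (\<omega> t)) \<partial>trajectory_measure S A Q \<pi> s)"

definition optimal_value ::
  "'s measure \<Rightarrow> 'b measure \<Rightarrow> ('s \<times> 'b \<Rightarrow> 's measure) \<Rightarrow> ('s \<times> 'b \<Rightarrow> ennreal) \<Rightarrow> real \<Rightarrow>
   's \<Rightarrow> ennreal" where
  "optimal_value S A Q c \<gamma> s = (INF \<pi>\<in>policies S A. policy_value S A Q c \<gamma> \<pi> s)"

lemma measurable_step_kernel:
  assumes Q: "Q \<in> S \<Otimes>\<^sub>M A \<rightarrow>\<^sub>M prob_algebra S" and \<pi>: "\<pi> \<in> policies S A"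
    and s: "s \<in> space S"
  shows "step_kernel S A Q \<pi> s t \<in> (\<Pi>\<^sub>M i\<in>{0..<t}. S \<Otimes>\<^sub>M A) \<rightarrow>\<^sub>M prob_algebra (S \<Otimes>\<^sub>M A)"
proof -
  have [measurable]: "\<pi> t \<in> (\<Pi>\<^sub>M i\<in>{0..<t}. S \<Otimes>\<^sub>M A) \<Otimes>\<^sub>M S \<rightarrow>\<^sub>M prob_algebra A"
    using \<pi> by (simp add: policies_def)
  have "state_kernel S Q s t \<in> (\<Pi>\<^sub>M i\<in>{0..<t}. S \<Otimes>\<^sub>M A) \<rightarrow>\<^sub>M prob_algebra S"
  proof (cases t)
    case 0
    have "return S s \<in> space (prob_algebra S)"
      using measurable_space[OF measurable_return_prob_space s] .
    then show ?thesis
      using 0 by (simp add: state_kernel_def[abs_def])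
  next
    case (Suc u)
    have "(\<lambda>h. h u) \<in> (\<Pi>\<^sub>M i\<in>{0..<t}. S \<Otimes>\<^sub>M A) \<rightarrow>\<^sub>M S \<Otimes>\<^sub>M A"
      using Suc by (intro measurable_component_singleton) simp
    from measurable_compose[OF this Q] show ?thesis
      using Suc by (simp add: state_kernel_def[abs_def])
  qed
  moreover have "(\<lambda>(h, y). return S y \<Otimes>\<^sub>M \<pi> t (h, y))
      \<in> (\<Pi>\<^sub>M i\<in>{0..<t}. S \<Otimes>\<^sub>M A) \<Otimes>\<^sub>M S \<rightarrow>\<^sub>M prob_algebra (S \<Otimes>\<^sub>M A)"
    unfolding case_prod_beta by (intro measurable_pair_prob) measurable
  ultimately show ?thesis
    unfolding step_kernel_def[abs_def] by (rule measurable_bind_prob_space2)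
qed

lemma Ionescu_Tulcea_step_kernel:
  assumes "Q \<in> S \<Otimes>\<^sub>M A \<rightarrow>\<^sub>M prob_algebra S" "\<pi> \<in> policies S A" "s \<in> space S"
  shows "Ionescu_Tulcea (step_kernel S A Q \<pi> s) (\<lambda>_. S \<Otimes>\<^sub>M A)"
proof (rule Ionescu_Tulcea.intro)
  fix i
  show "step_kernel S A Q \<pi> s i
      \<in> (\<Pi>\<^sub>M i\<in>{0..<i}. S \<Otimes>\<^sub>M A) \<rightarrow>\<^sub>M subprob_algebra (S \<Otimes>\<^sub>M A)"
    using measurable_step_kernel[OF assms] by (rule measurable_prob_algebraD)
  fix h :: "nat \<Rightarrow> 'a \<times> 'b"
  assume "h \<in> space (\<Pi>\<^sub>M i\<in>{0..<i}. S \<Otimes>\<^sub>M A)"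
  from measurable_space[OF measurable_step_kernel[OF assms] this]
  show "prob_space (step_kernel S A Q \<pi> s i h)"
    by (simp add: space_prob_algebra)
qed


section \<open>The restart problem\<close>

primrec kernel_pow :: "'a measure \<Rightarrow> ('a \<Rightarrow> 'a measure) \<Rightarrow> nat \<Rightarrow> 'a \<Rightarrow> 'a measure" where
  "kernel_pow M P 0 = return M"
| "kernel_pow M P (Suc k) = (\<lambda>x. kernel_pow M P k x \<bind> P)"

lemma measurable_kernel_pow:
  assumes "P \<in> M \<rightarrow>\<^sub>M prob_algebra M"
  shows "kernel_pow M P k \<in> M \<rightarrow>\<^sub>M prob_algebra M"
  by (induction k) (simp_all add: measurable_bind_prob_space assms)

datatype action = No_Intervention | Restart

definition restart_states :: "'a measure \<Rightarrow> ('a \<times> nat) measure" where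
  "restart_states M = M \<Otimes>\<^sub>M count_space UNIV"

definition restart_actions :: "action measure" where
  "restart_actions = count_space UNIV"

fun restart_kernel ::
  "'a measure \<Rightarrow> 'a measure \<Rightarrow> ('a \<times> nat) \<times> action \<Rightarrow> ('a \<times> nat) measure" where
  "restart_kernel M \<nu> ((x, k), No_Intervention) = return M x \<Otimes>\<^sub>M return (count_space UNIV) (k + 1)"
| "restart_kernel M \<nu> ((x, k), Restart) = \<nu> \<Otimes>\<^sub>M return (count_space UNIV) 0"

fun restart_cost ::
  "'a measure \<Rightarrow> ('a \<Rightarrow> 'a measure) \<Rightarrow> ('a \<Rightarrow> ennreal) \<Rightarrow> (action \<Rightarrow> ennreal) \<Rightarrow>
   ('a \<times> nat) \<times> action \<Rightarrow> ennreal" where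
  "restart_cost M P F G ((x, k), a) = (\<integral>\<^sup>+ y. F y \<partial>kernel_pow M P k x) + G a"

lemma measurable_restart_kernel:
  assumes \<nu>: "\<nu> \<in> space (prob_algebra M)"
  shows "restart_kernel M \<nu>
    \<in> restart_states M \<Otimes>\<^sub>M restart_actions \<rightarrow>\<^sub>M prob_algebra (restart_states M)"
proof -
  have *: "restart_kernel M \<nu> = (\<lambda>z. case snd z of
      No_Intervention \<Rightarrow> return M (fst (fst z)) \<Otimes>\<^sub>M return (count_space UNIV) (snd (fst z) + 1)
    | Restart \<Rightarrow> \<nu> \<Otimes>\<^sub>M return (count_space UNIV) 0)"
    by (rule ext) (auto split: action.split elim!: restart_kernel.elims)
  have fin: "countable (UNIV :: action set)"
  proof -
    have "(UNIV :: action set) = {No_Intervention, Restart}"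
      using action.exhaust by auto
    then show ?thesis
      by (metis countable_finite finite.emptyI finite.insertI)
  qed
  have [measurable]: "(\<lambda>_. \<nu>) \<in> N \<rightarrow>\<^sub>M prob_algebra M" for N :: "'c measure"
    using \<nu> by simp
  show ?thesis
    unfolding * restart_states_def restart_actions_def
  proof (rule measurable_compose_countable'[where I = UNIV and g = snd])
    fix a :: action
    show "(\<lambda>z. case a of
        No_Intervention \<Rightarrow> return M (fst (fst z)) \<Otimes>\<^sub>M return (count_space UNIV) (snd (fst z) + 1)
      | Restart \<Rightarrow> \<nu> \<Otimes>\<^sub>M return (count_space UNIV) 0)
      \<in> (M \<Otimes>\<^sub>M count_space (UNIV :: nat set)) \<Otimes>\<^sub>M count_space (UNIV :: action set)
        \<rightarrow>\<^sub>M prob_algebra (M \<Otimes>\<^sub>M count_space UNIV)"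
      by (cases a; simp; intro measurable_pair_prob; measurable)
  qed (use fin in simp_all)
qed

definition restart_value ::
  "'a measure \<Rightarrow> ('a \<Rightarrow> 'a measure) \<Rightarrow> 'a measure \<Rightarrow> ('a \<Rightarrow> ennreal) \<Rightarrow> (action \<Rightarrow> ennreal) \<Rightarrow>
   real \<Rightarrow> 'a \<Rightarrow> nat \<Rightarrow> ennreal" where
  "restart_value M P \<nu> F G \<gamma> x k =
     optimal_value (restart_states M) restart_actions
       (restart_kernel M \<nu>) (restart_cost M P F G) \<gamma> (x, k)"

definition restart_threshold_const ::
  "'a measure \<Rightarrow> ('a \<Rightarrow> 'a measure) \<Rightarrow> 'a measure \<Rightarrow> ('a \<Rightarrow> ennreal) \<Rightarrow> (action \<Rightarrow> ennreal) \<Rightarrow>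
   real \<Rightarrow> ennreal" where
  "restart_threshold_const M P \<nu> F G \<gamma> =
     G Restart + ennreal \<gamma> * (\<integral>\<^sup>+ z. restart_value M P \<nu> F G \<gamma> z 0 \<partial>\<nu>)"

text \<open>In \<^typ>\<open>enat\<close> the infimum of the empty set is \<open>\<infinity>\<close>.\<close>

definition threshold_index ::
  "'a measure \<Rightarrow> ('a \<Rightarrow> 'a measure) \<Rightarrow> 'a measure \<Rightarrow> ('a \<Rightarrow> ennreal) \<Rightarrow> (action \<Rightarrow> ennreal) \<Rightarrow>
   real \<Rightarrow> 'a \<Rightarrow> enat" where
  "threshold_index M P \<nu> F G \<gamma> x =
     Inf (enat ` {k. restart_threshold_const M P \<nu> F G \<gamma>
                      \<le> G No_Intervention + ennreal \<gamma> * restart_value M P \<nu> F G \<gamma> x (k + 1)})"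


section \<open>Stochastic monotonicity\<close>

definition stochastically_monotone ::
  "'a measure \<Rightarrow> 'a rel \<Rightarrow> ('a \<Rightarrow> 'a measure) \<Rightarrow> bool" where
  "stochastically_monotone M r P \<longleftrightarrow>
     (\<forall>g :: 'a \<Rightarrow> real.
        g \<in> borel_measurable M \<longrightarrow> bounded (g ` space M) \<longrightarrow>
        monotone_on (space M) (\<lambda>x y. (x, y) \<in> r) (\<le>) g \<longrightarrow>
        monotone_on (space M) (\<lambda>x y. (x, y) \<in> r) (\<le>) (\<lambda>x. \<integral>y. g y \<partial>P x))"

end

theory Submission
  imports Defs
begin

text \<open>
  It suffices that the value function is nondecreasing in the last observed state.  Let \<open>x \<le> x'\<close>
  and let \<open>\<pi>\<close> be a policy.  Started at \<open>(x, k)\<close>, the controller can pretend to have started at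
  \<open>(x', k)\<close>: up to the first restart the observed state is constant, so it replaces the state by
  \<open>x'\<close> in that part of the history and then acts as \<open>\<pi>\<close> would.  The two processes are coupled:
  they take the same actions, have the same elapsed times, and coincide after the first restart,
  since the restart law does not depend on the state.  Before the first restart the one-step
  cost at \<open>x\<close> is at most the one at \<open>x'\<close>, because stochastic monotonicity makes \<open>P\<^sup>k F\<close>
  nondecreasing.
\<close>

section \<open>Monotonicity of \<open>P^k F\<close> in the state\<close>

text \<open>Stochastic monotonicity is formulated for bounded real functions only. It applies to the
  truncations of \<open>g\<close> at the levels \<open>n\<close>, and monotone convergence carries
  the inequality to \<open>g\<close> itself.\<close>

lemma nn_integral_stochastically_monotone:
  fixes g :: "'a \<Rightarrow> ennreal"
  assumes P: "P \<in> M \<rightarrow>\<^sub>M prob_algebra M" and mono: "stochastically_monotone M r P"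
    and g: "g \<in> borel_measurable M" "monotone_on (space M) (\<lambda>x y. (x, y) \<in> r) (\<le>) g"
  shows "monotone_on (space M) (\<lambda>x y. (x, y) \<in> r) (\<le>) (\<lambda>x. \<integral>\<^sup>+ y. g y \<partial>P x)"
proof (rule monotone_onI)
  fix x x' assume x: "x \<in> space M" "x' \<in> space M" and r: "(x, x') \<in> r"
  \<comment> \<open>The truncation is finite, so \<open>enn2real\<close> loses nothing and preserves
    the order.\<close>
  define h where "h n y = enn2real (min (g y) (of_nat n))" for n y
  have h_meas [measurable]: "h n \<in> borel_measurable M" for n
    unfolding h_def using g by measurable
  have h_bound: "0 \<le> h n y" "h n y \<le> real n" for n y
    using enn2real_mono[of "min (g y) (of_nat n)" "of_nat n"]
    by (auto simp: h_def of_nat_less_top)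
  have h_ennreal: "ennreal (h n y) = min (g y) (of_nat n)" for n y
    unfolding h_def by (rule ennreal_enn2real) (simp add: min_less_iff_disj of_nat_less_top)
  have h_mono: "monotone_on (space M) (\<lambda>x y. (x, y) \<in> r) (\<le>) (h n)" for n
    using g(2) by (auto simp: monotone_on_def h_def min.coboundedI1 min_less_iff_disj of_nat_less_top intro!: enn2real_mono)
  have bdd: "bounded (h n ` space M)" for n
    using h_bound by (auto simp: bounded_iff intro!: exI[of _ "real n"])
  have le: "(\<integral>y. h n y \<partial>P x) \<le> (\<integral>y. h n y \<partial>P x')" for n
    using mono h_meas[of n] bdd h_mono x r
    unfolding stochastically_monotone_def monotone_on_def by blast
  have eq: "(\<integral>\<^sup>+ y. g y \<partial>P z) = (SUP n. ennreal (\<integral>y. h n y \<partial>P z))" if z: "z \<in> space M" for z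
  proof -
    have Pz: "prob_space (P z)" "sets (P z) = sets M"
      using measurable_space[OF P z] by (auto simp: space_prob_algebra)
    interpret prob_space "P z" by (rule Pz)
    have [measurable]: "h n \<in> borel_measurable (P z)" for n
      using h_meas[of n] by (simp add: measurable_cong_sets[OF Pz(2) refl])
    have int: "integrable (P z) (h n)" for n
      using h_bound by (intro integrable_const_bound[where B = "real n"]) auto
    \<comment> \<open>This includes the points with \<open>g y = \<infinity>\<close>, where the
      truncations are the numbers \<open>n\<close>.\<close>
    have sup: "(SUP n. min (g y) (of_nat n)) = g y" for y
    proof -
      have "(SUP n. min (g y) (of_nat n)) = min (g y) (SUP n. of_nat n)"
        by (simp add: inf_min[symmetric] inf_SUP)
      then show ?thesis by (simp add: ennreal_SUP_of_nat_eq_top)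
    qed
    have "(\<integral>\<^sup>+ y. g y \<partial>P z) = (\<integral>\<^sup>+ y. (SUP n. ennreal (h n y)) \<partial>P z)"
      by (simp add: h_ennreal sup)
    also have "\<dots> = (SUP n. \<integral>\<^sup>+ y. ennreal (h n y) \<partial>P z)"
    proof (rule nn_integral_monotone_convergence_SUP)
      show "incseq (\<lambda>n y. ennreal (h n y))"
        unfolding h_ennreal incseq_def le_fun_def by (intro allI impI min.mono order_refl of_nat_mono)
    qed measurable
    also have "\<dots> = (SUP n. ennreal (\<integral>y. h n y \<partial>P z))"
      using h_bound int by (simp add: nn_integral_eq_integral)
    finally show ?thesis .
  qed
  show "(\<integral>\<^sup>+ y. g y \<partial>P x) \<le> (\<integral>\<^sup>+ y. g y \<partial>P x')"
    unfolding eq[OF x(1)] eq[OF x(2)] using le by (intro SUP_mono) (auto intro: ennreal_leI)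
qed

text \<open>Since \<open>kernel_pow\<close> composes with \<open>P\<close> on the right, integrating
  \<open>g\<close> over \<open>k + 1\<close> steps is integrating \<open>P g\<close> over
  \<open>k\<close> steps. As \<open>P g\<close> is again nondecreasing, the induction runs over all
  \<open>g\<close> at once.\<close>

lemma nn_integral_kernel_pow_mono:
  assumes P: "P \<in> M \<rightarrow>\<^sub>M prob_algebra M" and mono: "stochastically_monotone M r P"
    and g: "g \<in> borel_measurable M" "monotone_on (space M) (\<lambda>x y. (x, y) \<in> r) (\<le>) g"
  shows "monotone_on (space M) (\<lambda>x y. (x, y) \<in> r) (\<le>) (\<lambda>x. \<integral>\<^sup>+ y. g y \<partial>kernel_pow M P k x)"
  using g
proof (induction k arbitrary: g)
  case 0
  then show ?case by (simp add: monotone_on_def nn_integral_return)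
next
  case (Suc k)
  note [measurable] = Suc.prems(1)
  have P': "P \<in> M \<rightarrow>\<^sub>M subprob_algebra M"
    using P by (rule measurable_prob_algebraD)
  have eq: "(\<integral>\<^sup>+ y. g y \<partial>kernel_pow M P (Suc k) x)
      = (\<integral>\<^sup>+ z. (\<integral>\<^sup>+ y. g y \<partial>P z) \<partial>kernel_pow M P k x)" if x: "x \<in> space M" for x
  proof -
    have "sets (kernel_pow M P k x) = sets M"
      using measurable_space[OF measurable_kernel_pow[OF P] x] by (simp add: space_prob_algebra)
    then have "P \<in> kernel_pow M P k x \<rightarrow>\<^sub>M subprob_algebra M"
      using P' by (simp cong: measurable_cong_sets)
    from nn_integral_bind[OF Suc.prems(1) this] show ?thesis by simp
  qed
  have "(\<lambda>z. \<integral>\<^sup>+ y. g y \<partial>P z) \<in> borel_measurable M"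
    using Suc.prems(1) P' by (rule nn_integral_measurable_subprob_algebra[THEN measurable_compose[rotated]])
  then have "monotone_on (space M) (\<lambda>x y. (x, y) \<in> r) (\<le>)
      (\<lambda>x. \<integral>\<^sup>+ z. (\<integral>\<^sup>+ y. g y \<partial>P z) \<partial>kernel_pow M P k x)"
    by (intro Suc.IH nn_integral_stochastically_monotone P mono Suc.prems)
  then show ?case
    using eq unfolding monotone_on_def by (metis (no_types, lifting))
qed

section \<open>Measurability of the cost, one-step integrals and finite horizons\<close>

lemma measurable_restart_cost:
  assumes P: "P \<in> M \<rightarrow>\<^sub>M prob_algebra M" and F: "F \<in> borel_measurable M"
  shows "restart_cost M P F G \<in> borel_measurable (restart_states M \<Otimes>\<^sub>M restart_actions)"
proof -
  have *: "restart_cost M P F G =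
      (\<lambda>z. (\<integral>\<^sup>+ y. F y \<partial>kernel_pow M P (snd (fst z)) (fst (fst z))) + G (snd z))"
    by (auto simp: fun_eq_iff)
  have [measurable]: "(\<lambda>x. \<integral>\<^sup>+ y. F y \<partial>kernel_pow M P k x) \<in> borel_measurable M" for k
    using F measurable_kernel_pow[OF P, of k, THEN measurable_prob_algebraD]
    by (rule nn_integral_measurable_subprob_algebra[THEN measurable_compose[rotated]])
  \<comment> \<open>The elapsed time is discrete, so a fixed power \<open>k\<close> can be treated
    at a time.\<close>
  have [measurable]: "(\<lambda>z. \<integral>\<^sup>+ y. F y \<partial>kernel_pow M P (snd (fst z)) (fst (fst z)))
      \<in> borel_measurable ((M \<Otimes>\<^sub>M count_space UNIV) \<Otimes>\<^sub>M count_space UNIV)"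
    by (rule measurable_compose_countable'[where I = UNIV and g = "\<lambda>z. snd (fst z)"]) simp_all
  have "(\<lambda>z. G (snd z)) \<in> borel_measurable ((M \<Otimes>\<^sub>M count_space (UNIV :: nat set)) \<Otimes>\<^sub>M count_space UNIV)"
    by (rule measurable_compose[OF measurable_snd]) simp
  then show ?thesis
    unfolding * restart_states_def restart_actions_def by (intro borel_measurable_add) measurable
qed

text \<open>Splitting a step into the draw of the state and the draw of the action isolates the
  state law, the only part in which the coupled processes can differ.\<close>

lemma nn_integral_step_kernel:
  assumes \<pi>: "\<pi> \<in> policies S A"
    and h: "h \<in> space (\<Pi>\<^sub>M i\<in>{0..<t}. S \<Otimes>\<^sub>M A)"
    and K: "state_kernel S Q s t h \<in> space (prob_algebra S)"
    and f: "f \<in> borel_measurable (S \<Otimes>\<^sub>M A)"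
  shows "(\<integral>\<^sup>+ z. f z \<partial>step_kernel S A Q \<pi> s t h)
    = (\<integral>\<^sup>+ y. (\<integral>\<^sup>+ a. f (y, a) \<partial>\<pi> t (h, y)) \<partial>state_kernel S Q s t h)"
proof -
  have \<pi>_t: "\<pi> t \<in> (\<Pi>\<^sub>M i\<in>{0..<t}. S \<Otimes>\<^sub>M A) \<Otimes>\<^sub>M S \<rightarrow>\<^sub>M prob_algebra A"
    using \<pi> by (simp add: policies_def)
  have \<pi>_h [measurable]: "(\<lambda>y. \<pi> t (h, y)) \<in> S \<rightarrow>\<^sub>M prob_algebra A"
    using h by (intro measurable_compose[OF _ \<pi>_t]) simp
  have sK: "sets (state_kernel S Q s t h) = sets S"
    using K by (simp add: space_prob_algebra)
  have "(\<lambda>y. return S y \<Otimes>\<^sub>M \<pi> t (h, y)) \<in> S \<rightarrow>\<^sub>M prob_algebra (S \<Otimes>\<^sub>M A)"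
    by (intro measurable_pair_prob) measurable
  then have N: "(\<lambda>y. return S y \<Otimes>\<^sub>M \<pi> t (h, y)) \<in> state_kernel S Q s t h \<rightarrow>\<^sub>M subprob_algebra (S \<Otimes>\<^sub>M A)"
    by (simp add: measurable_prob_algebraD sK cong: measurable_cong_sets)
  have "(\<integral>\<^sup>+ z. f z \<partial>(return S y \<Otimes>\<^sub>M \<pi> t (h, y))) = (\<integral>\<^sup>+ a. f (y, a) \<partial>\<pi> t (h, y))"
    if y: "y \<in> space S" for y
  proof -
    have sp: "sets (\<pi> t (h, y)) = sets A" "prob_space (\<pi> t (h, y))"
      using measurable_space[OF \<pi>_h y] by (auto simp: space_prob_algebra)
    interpret prob_space "\<pi> t (h, y)" by fact
    have [measurable_cong]: "sets (return S y \<Otimes>\<^sub>M \<pi> t (h, y)) = sets (S \<Otimes>\<^sub>M A)"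
      by (intro sets_pair_measure_cong) (simp_all add: sp)
    have f': "f \<in> borel_measurable (return S y \<Otimes>\<^sub>M \<pi> t (h, y))" 
      using f by measurable
    have "f \<in> borel_measurable (S \<Otimes>\<^sub>M \<pi> t (h, y))"
      using f sp(1) by (simp cong: measurable_cong_sets sets_pair_measure_cong)
    then have "(\<lambda>y'. \<integral>\<^sup>+ a. f (y', a) \<partial>\<pi> t (h, y)) \<in> borel_measurable S"
      by (rule borel_measurable_nn_integral_fst)
    \<comment> \<open>By Fubini the outer integral is against the Dirac measure at
      \<open>y\<close>.\<close>
    with y nn_integral_fst[OF f'] show ?thesis
      by (simp add: nn_integral_return)
  qed
  moreover have "space (state_kernel S Q s t h) = space S"
    using sK by (rule sets_eq_imp_space_eq)
  ultimately show ?thesis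
    unfolding step_kernel_def nn_integral_bind[OF f N] by (intro nn_integral_cong) simp
qed

text \<open>All terms are nonnegative, so monotone convergence reduces the infinite horizon to
  finite ones. The first \<open>n\<close> coordinates of a trajectory have the law
  \<open>C 0 n\<close> started at the empty history, which is encoded as
  \<open>\<lambda>_. undefined\<close>; this form admits induction on \<open>n\<close>.\<close>

lemma policy_value_eq_SUP:
  assumes Q: "Q \<in> S \<Otimes>\<^sub>M A \<rightarrow>\<^sub>M prob_algebra S" and \<pi>: "\<pi> \<in> policies S A"
    and s: "s \<in> space S" and c [measurable]: "c \<in> borel_measurable (S \<Otimes>\<^sub>M A)"
  shows "policy_value S A Q c \<gamma> \<pi> s =
    (SUP n. \<integral>\<^sup>+ h. (\<Sum>t<n. ennreal \<gamma> ^ t * c (h t))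
      \<partial>Ionescu_Tulcea.C (step_kernel S A Q \<pi> s) (\<lambda>_. S \<Otimes>\<^sub>M A) 0 n (\<lambda>_. undefined))"
proof -
  interpret IT: Ionescu_Tulcea "step_kernel S A Q \<pi> s" "\<lambda>_. S \<Otimes>\<^sub>M A"
    using Q \<pi> s by (rule Ionescu_Tulcea_step_kernel)
  have [measurable]: "(\<lambda>\<omega>. c (\<omega> t)) \<in> borel_measurable IT.PF.lim" for t
    using IT.PF.sets_lim by measurable
  have fin: "(\<integral>\<^sup>+ \<omega>. (\<Sum>t<n. ennreal \<gamma> ^ t * c (\<omega> t)) \<partial>IT.PF.lim)
      = (\<integral>\<^sup>+ h. (\<Sum>t<n. ennreal \<gamma> ^ t * c (h t)) \<partial>IT.C 0 n (\<lambda>_. undefined))" for n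
  proof -
    let ?f = "\<lambda>h. \<Sum>t<n. ennreal \<gamma> ^ t * c (h t)"
    have f [measurable]: "?f \<in> borel_measurable (\<Pi>\<^sub>M i\<in>{0..<n}. S \<Otimes>\<^sub>M A)"
      by measurable
    \<comment> \<open>\<open>CI J\<close> is the restriction to \<open>J\<close> of the process run
      up to time \<open>up_to J\<close>.\<close>
    have u: "IT.up_to {0..<n} = n"
      using IT.up_to_iff_Ico[of "{0..<n}" "IT.up_to {0..<n}"] IT.up_to_iff_Ico[of "{0..<n}" n]
      by (intro antisym) auto
    have "(\<integral>\<^sup>+ h. ?f h \<partial>IT.CI {0..<n})
        = (\<integral>\<^sup>+ \<omega>. ?f (restrict \<omega> {0..<n}) \<partial>IT.PF.lim)"
      unfolding IT.distr_lim[OF finite_atLeastLessThan, symmetric]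
      by (rule nn_integral_distr) (use f in \<open>simp_all add: measurable_cong_sets[OF IT.PF.sets_lim refl] measurable_restrict_subset\<close>)
    also have "\<dots> = (\<integral>\<^sup>+ \<omega>. ?f \<omega> \<partial>IT.PF.lim)"
      by (intro nn_integral_cong sum.cong) auto
    finally have "(\<integral>\<^sup>+ \<omega>. ?f \<omega> \<partial>IT.PF.lim) = (\<integral>\<^sup>+ h. ?f h \<partial>IT.CI {0..<n})" ..
    also have "\<dots> = (\<integral>\<^sup>+ h. ?f (restrict h {0..<n}) \<partial>IT.C 0 n (\<lambda>_. undefined))"
      unfolding IT.CI_def u
      by (rule nn_integral_distr) (use f in \<open>simp_all add: measurable_cong_sets[OF IT.sets_C refl] measurable_restrict_subset\<close>)
    also have "\<dots> = (\<integral>\<^sup>+ h. ?f h \<partial>IT.C 0 n (\<lambda>_. undefined))"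
      by (intro nn_integral_cong sum.cong) auto
    finally show ?thesis .
  qed
  have "policy_value S A Q c \<gamma> \<pi> s
      = (\<integral>\<^sup>+ \<omega>. (SUP n. \<Sum>t<n. ennreal \<gamma> ^ t * c (\<omega> t)) \<partial>IT.PF.lim)"
    by (simp add: policy_value_def trajectory_measure_def suminf_eq_SUP)
  also have "\<dots> = (SUP n. \<integral>\<^sup>+ \<omega>. (\<Sum>t<n. ennreal \<gamma> ^ t * c (\<omega> t)) \<partial>IT.PF.lim)"
    by (intro nn_integral_monotone_convergence_SUP)
       (auto simp: incseq_def le_fun_def intro!: sum_mono2)
  finally show ?thesis
    by (simp add: fin)
qed

section \<open>Comparison of two Ionescu-Tulcea processes\<close>

text \<open>
  Comparison of two processes along a coupling \<open>\<phi>\<close> of their histories; \<open>I n\<close> is an invariant of the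
  histories of length \<open>n\<close> of the first process.
\<close>

lemma Ionescu_Tulcea_nn_integral_C_le:
  fixes N :: "nat \<Rightarrow> 'a measure"
  assumes K: "Ionescu_Tulcea K N" and L: "Ionescu_Tulcea L N"
    and I_0: "(\<lambda>_. undefined) \<in> I 0" and \<phi>_0: "\<phi> 0 (\<lambda>_. undefined) = (\<lambda>_. undefined)"
    and I: "\<And>n h. h \<in> I n \<Longrightarrow> h \<in> space (PiM {0..<n} N)"
    and \<phi>: "\<And>n h. h \<in> I n \<Longrightarrow> \<phi> n h \<in> space (PiM {0..<n} N)"
    and step: "\<And>n h f g. h \<in> I n \<Longrightarrow> f \<in> borel_measurable (PiM {0..<Suc n} N) \<Longrightarrow>
      g \<in> borel_measurable (PiM {0..<Suc n} N) \<Longrightarrow>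
      (\<And>h'. h' \<in> I (Suc n) \<Longrightarrow> f h' \<le> g (\<phi> (Suc n) h')) \<Longrightarrow>
      (\<integral>\<^sup>+ z. f (h(n := z)) \<partial>K n h) \<le> (\<integral>\<^sup>+ z. g ((\<phi> n h)(n := z)) \<partial>L n (\<phi> n h))"
    and f: "f \<in> borel_measurable (PiM {0..<n} N)" and g: "g \<in> borel_measurable (PiM {0..<n} N)"
    and le: "\<And>h. h \<in> I n \<Longrightarrow> f h \<le> g (\<phi> n h)"
  shows "(\<integral>\<^sup>+ h. f h \<partial>Ionescu_Tulcea.C K N 0 n (\<lambda>_. undefined))
    \<le> (\<integral>\<^sup>+ h. g h \<partial>Ionescu_Tulcea.C L N 0 n (\<lambda>_. undefined :: 'a))"
proof -
  interpret K: Ionescu_Tulcea K N by fact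
  interpret L: Ionescu_Tulcea L N by fact
  have u: "(\<lambda>_. undefined) \<in> space (PiM {0..<0} N)"
    by simp
  show ?thesis
    using f g le
  proof (induction n arbitrary: f g)
    case 0
    \<comment> \<open>Both laws are Dirac at the empty history, which the coupling fixes.\<close>
    from 0(3)[OF I_0] 0(1,2) u show ?case
      by (simp add: nn_integral_return \<phi>_0)
  next
    case (Suc n)
    note [measurable] = Suc.prems(1,2)
    have 1: "(\<integral>\<^sup>+ h. f h \<partial>K.C 0 (Suc n) (\<lambda>_. undefined))
        = (\<integral>\<^sup>+ h. (\<integral>\<^sup>+ h'. f h' \<partial>K.eP n h) \<partial>K.C 0 n (\<lambda>_. undefined))"
      using K.measurable_eP[of n] K.sets_C[OF u, of n]
      by (simp add: nn_integral_bind[OF Suc.prems(1)] cong: measurable_cong_sets)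
    have 2: "(\<integral>\<^sup>+ h. g h \<partial>L.C 0 (Suc n) (\<lambda>_. undefined))
        = (\<integral>\<^sup>+ h. (\<integral>\<^sup>+ h'. g h' \<partial>L.eP n h) \<partial>L.C 0 n (\<lambda>_. undefined))"
      using L.measurable_eP[of n] L.sets_C[OF u, of n]
      by (simp add: nn_integral_bind[OF Suc.prems(2)] cong: measurable_cong_sets)
    show ?case
      unfolding 1 2
    \<comment> \<open>Integrating out the last entry leaves two functions of histories of length
      \<open>n\<close>; \<open>step\<close> is exactly their comparison along the coupling.\<close>
    proof (rule Suc.IH)
      show "(\<lambda>h. \<integral>\<^sup>+ h'. f h' \<partial>K.eP n h) \<in> borel_measurable (PiM {0..<n} N)"
        using Suc.prems(1) K.measurable_eP
        by (rule nn_integral_measurable_subprob_algebra[THEN measurable_compose[rotated]])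
      show "(\<lambda>h. \<integral>\<^sup>+ h'. g h' \<partial>L.eP n h) \<in> borel_measurable (PiM {0..<n} N)"
        using Suc.prems(2) L.measurable_eP
        by (rule nn_integral_measurable_subprob_algebra[THEN measurable_compose[rotated]])
      fix h assume h: "h \<in> I n"
      show "(\<integral>\<^sup>+ h'. f h' \<partial>K.eP n h) \<le> (\<integral>\<^sup>+ h'. g h' \<partial>L.eP n (\<phi> n h))"
        unfolding K.nn_integral_eP[OF I[OF h] Suc.prems(1)] L.nn_integral_eP[OF \<phi>[OF h] Suc.prems(2)]
        using h Suc.prems by (rule step)
    qed
  qed
qed

section \<open>Dirac laws and relabelled histories\<close>

lemma pair_measure_return:
  assumes "x \<in> space M" "y \<in> space N"
  shows "return M x \<Otimes>\<^sub>M return N y = return (M \<Otimes>\<^sub>M N) (x, y)"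
proof -
  interpret N: prob_space "return N y" using assms by (intro prob_space_return)
  show ?thesis
  proof (rule measure_eqI)
    show "sets (return M x \<Otimes>\<^sub>M return N y) = sets (return (M \<Otimes>\<^sub>M N) (x, y))"
      by (simp cong: sets_pair_measure_cong)
    fix A assume A: "A \<in> sets (return M x \<Otimes>\<^sub>M return N y)"
    then have A': "A \<in> sets (M \<Otimes>\<^sub>M N)"
      by (simp cong: sets_pair_measure_cong)
    have sl: "Pair x' -` A \<in> sets N" for x'
      using A' by (rule sets_Pair1)
    have "{x' \<in> space M. (x', y) \<in> A} \<in> sets M"
      using sets_Pair2[OF A', of y] sets.sets_into_space[OF A']
      by (auto simp: vimage_def space_pair_measure Int_def[symmetric] elim!: back_subst[of "\<lambda>B. B \<in> sets M"])
    then have "(\<lambda>x'. indicator (Pair x' -` A) y :: ennreal) \<in> borel_measurable M"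
      by (simp add: indicator_def measurable_If_set)
    then show "emeasure (return M x \<Otimes>\<^sub>M return N y) A = emeasure (return (M \<Otimes>\<^sub>M N) (x, y)) A"
      using A A' assms by (simp add: N.emeasure_pair_measure_alt sl nn_integral_return indicator_def)
  qed
qed

text \<open>The action at time \<open>t\<close> itself is not inspected: it is chosen after the
  state at time \<open>t\<close>, so that state is still the one held before a restart.\<close>

definition no_restart :: "nat \<Rightarrow> (nat \<Rightarrow> 's \<times> action) \<Rightarrow> bool" where
  "no_restart t h \<longleftrightarrow> (\<forall>i<t. snd (h i) = No_Intervention)"

text \<open>
  The history as it would look had the process started at \<open>x\<close>: the observed states up to and
  including the one at which the first restart is chosen are replaced by \<open>x\<close>.
\<close>

definition relabel_state ::
  "'a \<Rightarrow> nat \<Rightarrow> (nat \<Rightarrow> ('a \<times> nat) \<times> action) \<Rightarrow> 'a \<times> nat \<Rightarrow> 'a \<times> nat" where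
  "relabel_state x t h s = (if no_restart t h then (x, snd s) else s)"

definition relabel ::
  "'a \<Rightarrow> nat \<Rightarrow> (nat \<Rightarrow> ('a \<times> nat) \<times> action) \<Rightarrow> nat \<Rightarrow> ('a \<times> nat) \<times> action" where
  "relabel x t h = (\<lambda>i\<in>{0..<t}. (relabel_state x i h (fst (h i)), snd (h i)))"

text \<open>Here \<open>x\<close> is the pretended initial state; the true one does not enter, since
  it is overwritten wherever it would be seen.\<close>

definition relabel_policy ::
  "'a \<Rightarrow> (nat \<Rightarrow> (nat \<Rightarrow> ('a \<times> nat) \<times> action) \<times> ('a \<times> nat) \<Rightarrow> action measure) \<Rightarrow>
   nat \<Rightarrow> (nat \<Rightarrow> ('a \<times> nat) \<times> action) \<times> ('a \<times> nat) \<Rightarrow> action measure" where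
  "relabel_policy x \<pi> t = (\<lambda>(h, s). \<pi> t (relabel x t h, relabel_state x t h s))"

lemma no_restart_upd: "i \<le> n \<Longrightarrow> no_restart i (h(n := z)) \<longleftrightarrow> no_restart i h"
  by (auto simp: no_restart_def)

lemma relabel_state_upd: "i \<le> n \<Longrightarrow> relabel_state x i (h(n := z)) = relabel_state x i h"
  by (simp add: relabel_state_def no_restart_upd fun_eq_iff)

text \<open>Each entry is relabelled according to strictly earlier actions, so appending an entry
  leaves the relabelled past intact. This makes the coupling compatible with single steps.\<close>

lemma relabel_upd:
  "relabel x (Suc n) (h(n := z)) = (relabel x n h)(n := (relabel_state x n h (fst z), snd z))"
  by (auto simp: relabel_def fun_eq_iff restrict_def relabel_state_upd)

text \<open>The case \<open>i = t\<close> serves the current state, the cases \<open>i < t\<close>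
  serve the states inside the history.\<close>

lemma measurable_relabel_state:
  assumes x: "x \<in> space M" and i: "i \<le> t"
  shows "(\<lambda>(h, s). relabel_state x i h s)
    \<in> (\<Pi>\<^sub>M i\<in>{0..<t}. restart_states M \<Otimes>\<^sub>M restart_actions) \<Otimes>\<^sub>M restart_states M \<rightarrow>\<^sub>M restart_states M"
proof -
  let ?N = "(\<Pi>\<^sub>M i\<in>{0..<t}. restart_states M \<Otimes>\<^sub>M restart_actions) \<Otimes>\<^sub>M restart_states M"
  have [measurable]: "Measurable.pred ?N (\<lambda>z. no_restart i (fst z))"
    unfolding no_restart_def
  proof (intro pred_intros_countable pred_intros_imp')
    fix j assume "j < i"
    with i have "j \<in> {0..<t}"
      by simp
    from measurable_compose[OF measurable_fst measurable_component_singleton[OF this]]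
    have "(\<lambda>z. fst z j) \<in> ?N \<rightarrow>\<^sub>M restart_states M \<Otimes>\<^sub>M restart_actions" .
    from measurable_compose[OF this measurable_snd]
    show "Measurable.pred ?N (\<lambda>z. snd (fst z j) = No_Intervention)"
      by (rule measurable_compose) (simp add: restart_actions_def)
  qed
  have [measurable]: "(\<lambda>s. (x, snd s)) \<in> restart_states M \<rightarrow>\<^sub>M restart_states M"
    using x unfolding restart_states_def by measurable
  have [measurable]: "(\<lambda>z. (x, snd (snd z))) \<in> ?N \<rightarrow>\<^sub>M restart_states M"
    by (rule measurable_compose[OF measurable_snd]) measurable
  have "(\<lambda>z. if no_restart i (fst z) then (x, snd (snd z)) else snd z) \<in> ?N \<rightarrow>\<^sub>M restart_states M"
    by (rule measurable_If) measurable
  then show ?thesis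
    by (simp add: relabel_state_def case_prod_beta')
qed

lemma measurable_relabel:
  assumes x: "x \<in> space M"
  shows "relabel x t \<in> (\<Pi>\<^sub>M i\<in>{0..<t}. restart_states M \<Otimes>\<^sub>M restart_actions)
    \<rightarrow>\<^sub>M (\<Pi>\<^sub>M i\<in>{0..<t}. restart_states M \<Otimes>\<^sub>M restart_actions)"
  unfolding relabel_def
proof (rule measurable_restrict)
  let ?H = "\<Pi>\<^sub>M i\<in>{0..<t}. restart_states M \<Otimes>\<^sub>M restart_actions"
  fix i assume i: "i \<in> {0..<t}"
  have *: "(\<lambda>h. h i) \<in> ?H \<rightarrow>\<^sub>M restart_states M \<Otimes>\<^sub>M restart_actions"
    using i by (rule measurable_component_singleton)
  have "(\<lambda>h. (h, fst (h i))) \<in> ?H \<rightarrow>\<^sub>M ?H \<Otimes>\<^sub>M restart_states M"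
    using * by (intro measurable_Pair measurable_ident measurable_compose[OF *]) simp_all
  from measurable_compose[OF this measurable_relabel_state[OF x]] i
  have "(\<lambda>h. relabel_state x i h (fst (h i))) \<in> ?H \<rightarrow>\<^sub>M restart_states M"
    by simp
  with * show "(\<lambda>h. (relabel_state x i h (fst (h i)), snd (h i)))
      \<in> ?H \<rightarrow>\<^sub>M restart_states M \<Otimes>\<^sub>M restart_actions"
    by (intro measurable_Pair measurable_compose[OF *]) simp_all
qed

lemma relabel_policy_in_policies:
  assumes x: "x \<in> space M" and \<pi>: "\<pi> \<in> policies (restart_states M) restart_actions"
  shows "relabel_policy x \<pi> \<in> policies (restart_states M) restart_actions"
  unfolding policies_def
proof safe
  fix t :: nat
  let ?H = "\<Pi>\<^sub>M i\<in>{0..<t}. restart_states M \<Otimes>\<^sub>M restart_actions"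
  have \<pi>_t: "\<pi> t \<in> ?H \<Otimes>\<^sub>M restart_states M \<rightarrow>\<^sub>M prob_algebra restart_actions"
    using \<pi> by (simp add: policies_def)
  have "(\<lambda>z. (relabel x t (fst z), relabel_state x t (fst z) (snd z)))
      \<in> ?H \<Otimes>\<^sub>M restart_states M \<rightarrow>\<^sub>M ?H \<Otimes>\<^sub>M restart_states M"
    using measurable_relabel_state[OF x, of t t]
    by (intro measurable_Pair measurable_compose[OF measurable_fst measurable_relabel[OF x]])
       (simp add: case_prod_beta')
  from measurable_compose[OF this \<pi>_t]
  show "relabel_policy x \<pi> t \<in> ?H \<Otimes>\<^sub>M restart_states M \<rightarrow>\<^sub>M prob_algebra restart_actions"
    by (simp add: relabel_policy_def case_prod_beta')
qed

section \<open>State laws before and after the first restart\<close>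

text \<open>The next state depends on the last entry only. If the first restart is chosen there, the
  restart law ignores the relabelled state; if it came earlier, the entry is unchanged by
  \<open>relabel\<close>. A restart in the past excludes \<open>t = 0\<close>, so the initial states
  may differ.\<close>

lemma state_kernel_relabel_restarted:
  assumes "\<not> no_restart t h"
  shows "state_kernel S (restart_kernel M \<nu>) s t h
    = state_kernel S (restart_kernel M \<nu>) s' t (relabel x t h)"
proof -
  from assms obtain u where t: "t = Suc u"
    by (cases t) (auto simp: no_restart_def)
  show ?thesis
  proof (cases "no_restart u h")
    case True
    with assms t have "snd (h u) \<noteq> No_Intervention"
      by (auto simp: no_restart_def less_Suc_eq)
    then have "snd (h u) = Restart"
      by (cases "snd (h u)") auto
    then show ?thesis
      using t by (cases "h u"; cases "fst (h u)") (simp add: state_kernel_def relabel_def relabel_state_def)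
  next
    case False
    then show ?thesis
      using t by (simp add: state_kernel_def relabel_def relabel_state_def)
  qed
qed

text \<open>Without a restart the state moves deterministically, with the same elapsed time on both
  sides. As \<open>h\<close> is an arbitrary point of the history space, its last observed state
  \<open>y\<close> need not be \<open>x\<close>; \<open>le\<close> keeps it below
  \<open>x'\<close>.\<close>

lemma state_kernel_relabel_unrestarted:
  assumes h: "h \<in> space (\<Pi>\<^sub>M i\<in>{0..<t}. restart_states M \<Otimes>\<^sub>M restart_actions)" and n: "no_restart t h"
    and x: "x \<in> space M" "x' \<in> space M" "(x, x') \<in> r"
    and le: "\<And>i. i < t \<Longrightarrow> no_restart i h \<Longrightarrow> (fst (fst (h i)), x') \<in> r"
  obtains y j where "y \<in> space M" "(y, x') \<in> r"
    "state_kernel (restart_states M) (restart_kernel M \<nu>) (x, k) t h = return (restart_states M) (y, j)"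
    "state_kernel (restart_states M) (restart_kernel M \<nu>) (x', k) t (relabel x' t h)
      = return (restart_states M) (x', j)"
proof (cases t)
  case 0
  \<comment> \<open>At time \<open>0\<close> the witnesses are the initial data \<open>x\<close> and
    \<open>k\<close>.\<close>
  with x that[of x k] show ?thesis by (simp add: state_kernel_def)
next
  case (Suc u)
  obtain y j a where hu: "h u = ((y, j), a)"
    by (metis surj_pair)
  have n': "no_restart u h" and a: "a = No_Intervention"
    using n Suc hu by (auto simp: no_restart_def dest: spec[of _ u])
  have "h u \<in> space (restart_states M \<Otimes>\<^sub>M restart_actions)"
    using h Suc by (auto simp: space_PiM)
  then have y: "y \<in> space M"
    using hu by (auto simp: space_pair_measure restart_states_def)
  have "(y, x') \<in> r"
    using le[of u] Suc n' hu by simp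
  with y x(2) show ?thesis
    using Suc hu a n'
    by (intro that[of y "j + 1"])
       (simp_all add: state_kernel_def relabel_def relabel_state_def pair_measure_return restart_states_def)
qed

section \<open>Monotonicity of the value function\<close>

lemma restart_value_mono:
  assumes P: "P \<in> M \<rightarrow>\<^sub>M prob_algebra M" and \<nu>: "\<nu> \<in> space (prob_algebra M)"
    and F: "F \<in> borel_measurable M" "monotone_on (space M) (\<lambda>x y. (x, y) \<in> r) (\<le>) F"
    and mono: "stochastically_monotone M r P"
    and x: "x \<in> space M" "x' \<in> space M" "(x, x') \<in> r"
  shows "restart_value M P \<nu> F G \<gamma> x k \<le> restart_value M P \<nu> F G \<gamma> x' k"
  unfolding restart_value_def optimal_value_def
proof (rule INF_mono)
  let ?S = "restart_states M" and ?A = restart_actions and ?Q = "restart_kernel M \<nu>"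
    and ?c = "restart_cost M P F G"
  let ?N = "\<lambda>n::nat. \<Pi>\<^sub>M i\<in>{0..<n}. ?S \<Otimes>\<^sub>M ?A"
  fix \<pi> assume \<pi>: "\<pi> \<in> policies ?S ?A"
  \<comment> \<open>The imitating policy, to be run from \<open>(x, k)\<close>.\<close>
  let ?\<pi>' = "relabel_policy x' \<pi>"
  have \<pi>': "?\<pi>' \<in> policies ?S ?A"
    using x(2) \<pi> by (rule relabel_policy_in_policies)
  have Q: "?Q \<in> ?S \<Otimes>\<^sub>M ?A \<rightarrow>\<^sub>M prob_algebra ?S"
    using \<nu> by (rule measurable_restart_kernel)
  have state_space: "(y, j) \<in> space ?S" if "y \<in> space M" for y j
    using that by (simp add: restart_states_def space_pair_measure)
  note s = state_space[OF x(1), of k] state_space[OF x(2), of k]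
  have c [measurable]: "?c \<in> borel_measurable (?S \<Otimes>\<^sub>M ?A)"
    using P F(1) by (rule measurable_restart_cost)
  have c_mono: "?c ((y, j), a) \<le> ?c ((x', j), a)" if "y \<in> space M" "(y, x') \<in> r" for y j a
    using monotone_onD[OF nn_integral_kernel_pow_mono[OF P mono F] that(1) x(2) that(2)]
    by (simp add: add_right_mono)
  \<comment> \<open>Observed states stay below \<open>x'\<close> up to and including the one at
    which the first restart is chosen; from then on the coupled states agree.\<close>
  define I where "I n = {h \<in> space (?N n). \<forall>i<n. no_restart i h \<longrightarrow> (fst (fst (h i)), x') \<in> r}" for n
  have I_D: "h \<in> space (?N n)" "relabel x' n h \<in> space (?N n)" if "h \<in> I n" for n h
    using that measurable_space[OF measurable_relabel[OF x(2)]] by (auto simp: I_def)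
  have K_prob: "state_kernel ?S ?Q s t h \<in> space (prob_algebra ?S)"
    if "h \<in> space (?N t)" "s \<in> space ?S" for s t h
  proof (cases t)
    case 0
    then show ?thesis
      using that by (simp add: state_kernel_def space_prob_algebra prob_space_return)
  next
    case (Suc u)
    with that have "h u \<in> space (?S \<Otimes>\<^sub>M ?A)"
      by (auto simp: space_PiM)
    from measurable_space[OF Q this] Suc show ?thesis
      by (simp add: state_kernel_def)
  qed
  \<comment> \<open>Needed to evaluate integrals against Dirac state laws, for both
    \<open>\<pi>\<close> and the imitating policy.\<close>
  have value_meas: "(\<lambda>s. \<integral>\<^sup>+ a. f (s, a) \<partial>p n (h, s)) \<in> borel_measurable ?S"
    if "p \<in> policies ?S ?A" "h \<in> space (?N n)" "f \<in> borel_measurable (?S \<Otimes>\<^sub>M ?A)" for f p n h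
  proof (rule nn_integral_measurable_subprob_algebra2)
    have "p n \<in> ?N n \<Otimes>\<^sub>M ?S \<rightarrow>\<^sub>M prob_algebra ?A"
      using that by (simp add: policies_def)
    then show "(\<lambda>s. p n (h, s)) \<in> ?S \<rightarrow>\<^sub>M subprob_algebra ?A"
      using that(2) by (intro measurable_prob_algebraD measurable_compose[where f = "Pair h" and g = "p n"]) simp_all
  qed (use that in simp)
  have "(\<integral>\<^sup>+ h. (\<Sum>t<n. ennreal \<gamma> ^ t * ?c (h t))
        \<partial>Ionescu_Tulcea.C (step_kernel ?S ?A ?Q ?\<pi>' (x, k)) (\<lambda>_. ?S \<Otimes>\<^sub>M ?A) 0 n (\<lambda>_. undefined))
      \<le> (\<integral>\<^sup>+ h. (\<Sum>t<n. ennreal \<gamma> ^ t * ?c (h t))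
        \<partial>Ionescu_Tulcea.C (step_kernel ?S ?A ?Q \<pi> (x', k)) (\<lambda>_. ?S \<Otimes>\<^sub>M ?A) 0 n (\<lambda>_. undefined))" for n
  proof (rule Ionescu_Tulcea_nn_integral_C_le[where I = I and \<phi> = "relabel x'"])
    show "(\<lambda>_. undefined) \<in> I 0"
      by (simp add: I_def)
    show "relabel x' 0 (\<lambda>_. undefined) = (\<lambda>_. undefined)"
      by (simp add: relabel_def fun_eq_iff)
    show "(\<Sum>t<n. ennreal \<gamma> ^ t * ?c (h t)) \<le> (\<Sum>t<n. ennreal \<gamma> ^ t * ?c (relabel x' n h t))"
      if h: "h \<in> I n" for h
    \<comment> \<open>The costs compare term by term: an entry is either unchanged or has its state
      raised to \<open>x'\<close>.\<close>
    proof (intro sum_mono mult_left_mono)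
      fix t assume t: "t \<in> {..<n}"
      obtain y j a where ht: "h t = ((y, j), a)"
        by (metis surj_pair)
      have "h t \<in> space (?S \<Otimes>\<^sub>M ?A)"
        using I_D(1)[OF h] t by (auto simp: space_PiM)
      then have "y \<in> space M"
        using ht by (auto simp: space_pair_measure restart_states_def)
      moreover have "(y, x') \<in> r" if "no_restart t h"
        using that h t ht by (force simp: I_def)
      ultimately show "?c (h t) \<le> ?c (relabel x' n h t)"
        using t ht c_mono[of y j a] by (auto simp: relabel_def relabel_state_def)
    qed simp
  next
    fix n h and f g :: "(nat \<Rightarrow> ('a \<times> nat) \<times> action) \<Rightarrow> ennreal"
    assume h: "h \<in> I n" and f: "f \<in> borel_measurable (?N (Suc n))"
      and g: "g \<in> borel_measurable (?N (Suc n))"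
      and le: "\<And>h'. h' \<in> I (Suc n) \<Longrightarrow> f h' \<le> g (relabel x' (Suc n) h')"
    have upd: "(\<lambda>z. h'(n := z)) \<in> ?S \<Otimes>\<^sub>M ?A \<rightarrow>\<^sub>M ?N (Suc n)" if "h' \<in> space (?N n)" for h'
      using that by (intro measurable_fun_upd[where J = "{0..<n}"]) auto
    have f': "(\<lambda>z. f (h(n := z))) \<in> borel_measurable (?S \<Otimes>\<^sub>M ?A)"
      using measurable_compose[OF upd f] I_D[OF h] by simp
    have g': "(\<lambda>z. g ((relabel x' n h)(n := z))) \<in> borel_measurable (?S \<Otimes>\<^sub>M ?A)"
      using measurable_compose[OF upd g] I_D[OF h] by simp
    note K = K_prob[OF I_D(1)[OF h] s(1)] K_prob[OF I_D(2)[OF h] s(2)]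
    \<comment> \<open>Once the coupled states are fixed, both sides draw the action from the same
      law by the choice of the imitating policy, so the integrands compare pointwise on extended
      histories in \<open>I (Suc n)\<close>.\<close>
    have inner: "(\<integral>\<^sup>+ a. f (h(n := ((y, j), a))) \<partial>?\<pi>' n (h, (y, j)))
        \<le> (\<integral>\<^sup>+ a. g ((relabel x' n h)(n := (relabel_state x' n h (y, j), a)))
            \<partial>\<pi> n (relabel x' n h, relabel_state x' n h (y, j)))"
      if y: "y \<in> space M" "no_restart n h \<Longrightarrow> (y, x') \<in> r" for y j
    proof -
      have "h(n := ((y, j), a)) \<in> I (Suc n)" for a
        using h y measurable_space[OF upd[OF I_D(1)[OF h]], of "((y, j), a)"]
        by (auto simp: I_def no_restart_upd less_Suc_eq space_pair_measure restart_states_def restart_actions_def)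
      from le[OF this] show ?thesis
        by (auto simp: relabel_policy_def relabel_upd intro!: nn_integral_mono)
    qed
    show "(\<integral>\<^sup>+ z. f (h(n := z)) \<partial>step_kernel ?S ?A ?Q ?\<pi>' (x, k) n h)
      \<le> (\<integral>\<^sup>+ z. g ((relabel x' n h)(n := z)) \<partial>step_kernel ?S ?A ?Q \<pi> (x', k) n (relabel x' n h))"
      unfolding nn_integral_step_kernel[OF \<pi>' I_D(1)[OF h] K(1) f']
        nn_integral_step_kernel[OF \<pi> I_D(2)[OF h] K(2) g']
    proof (cases "no_restart n h")
      case True
      have "(fst (fst (h i)), x') \<in> r" if "i < n" "no_restart i h" for i
        using h that by (simp add: I_def)
      from state_kernel_relabel_unrestarted[OF I_D(1)[OF h] True x this]
      obtain y j where y: "y \<in> space M" "(y, x') \<in> r"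
        and kernels: "state_kernel ?S ?Q (x, k) n h = return ?S (y, j)"
          "state_kernel ?S ?Q (x', k) n (relabel x' n h) = return ?S (x', j)"
        by blast
      show "(\<integral>\<^sup>+ s. (\<integral>\<^sup>+ a. f (h(n := (s, a))) \<partial>?\<pi>' n (h, s)) \<partial>state_kernel ?S ?Q (x, k) n h)
        \<le> (\<integral>\<^sup>+ s. (\<integral>\<^sup>+ a. g ((relabel x' n h)(n := (s, a))) \<partial>\<pi> n (relabel x' n h, s))
            \<partial>state_kernel ?S ?Q (x', k) n (relabel x' n h))"
        using inner[of y j] y x(2) True
          value_meas[OF \<pi>' I_D(1)[OF h] f'] value_meas[OF \<pi> I_D(2)[OF h] g']
          state_space[OF y(1), of j] state_space[OF x(2), of j]
        by (simp add: kernels nn_integral_return relabel_state_def)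
    next
      \<comment> \<open>After a restart the two state laws coincide and \<open>relabel_state\<close>
        is the identity, so \<open>inner\<close> is integrated over one common law.\<close>
      case False
      have "space (state_kernel ?S ?Q (x, k) n h) = space ?S"
        using K(1) by (auto simp: space_prob_algebra dest: sets_eq_imp_space_eq)
      then show "(\<integral>\<^sup>+ s. (\<integral>\<^sup>+ a. f (h(n := (s, a))) \<partial>?\<pi>' n (h, s)) \<partial>state_kernel ?S ?Q (x, k) n h)
        \<le> (\<integral>\<^sup>+ s. (\<integral>\<^sup>+ a. g ((relabel x' n h)(n := (s, a))) \<partial>\<pi> n (relabel x' n h, s))
            \<partial>state_kernel ?S ?Q (x', k) n (relabel x' n h))"
        using False inner
        unfolding state_kernel_relabel_restarted[OF False, of ?S M \<nu> "(x, k)" "(x', k)" x', symmetric]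
        by (intro nn_integral_mono)
           (auto simp: relabel_state_def restart_states_def space_pair_measure)
    qed
  qed (use I_D Ionescu_Tulcea_step_kernel[OF Q \<pi>' s(1)] Ionescu_Tulcea_step_kernel[OF Q \<pi> s(2)] in \<open>measurable; simp\<close>)+
  then have "policy_value ?S ?A ?Q ?c \<gamma> ?\<pi>' (x, k) \<le> policy_value ?S ?A ?Q ?c \<gamma> \<pi> (x', k)"
    unfolding policy_value_eq_SUP[OF Q \<pi>' s(1) c] policy_value_eq_SUP[OF Q \<pi> s(2) c]
    by (intro SUP_mono) blast
  with \<pi>' show "\<exists>\<pi>'\<in>policies ?S ?A. policy_value ?S ?A ?Q ?c \<gamma> \<pi>' (x, k)
      \<le> policy_value ?S ?A ?Q ?c \<gamma> \<pi> (x', k)"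
    by blast
qed

section \<open>Passage to the threshold index\<close>

theorem theorem2:
  fixes X :: "'a::polish_space set" and M :: "'a measure"
    and P :: "'a \<Rightarrow> 'a measure" and \<nu> :: "'a measure"
    and F :: "'a \<Rightarrow> ennreal" and G :: "action \<Rightarrow> ennreal"
    and r :: "'a rel" and \<gamma> :: real
  assumes borel_X: "X \<in> sets borel"
    and M_def: "M = restrict_space borel X"
    and P_kernel: "P \<in> M \<rightarrow>\<^sub>M prob_algebra M"
    and nu_prob: "\<nu> \<in> space (prob_algebra M)"
    and F_meas: "F \<in> borel_measurable M"
    and G_finite: "\<And>a. G a < \<infinity>"
    and order: "partial_order_on X r"
    and upper_sets: "\<And>x. x \<in> X \<Longrightarrow> {y \<in> X. (x, y) \<in> r} \<in> sets M"
    and F_mono: "monotone_on X (\<lambda>x y. (x, y) \<in> r) (\<le>) F"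
    and P_mono: "stochastically_monotone M r P"
    and PF_ge: "\<And>x. x \<in> X \<Longrightarrow> (\<integral>\<^sup>+ y. F y \<partial>P x) \<ge> F x"
    and gamma: "0 < \<gamma>" "\<gamma> \<le> 1"
  shows "\<forall>x\<in>X. \<forall>x'\<in>X. (x, x') \<in> r \<longrightarrow>
    threshold_index M P \<nu> F G \<gamma> x \<ge> threshold_index M P \<nu> F G \<gamma> x'"
proof (intro ballI impI)
  fix x x' assume x: "x \<in> X" "x' \<in> X" "(x, x') \<in> r"
  have X: "space M = X"
    using borel_X by (simp add: M_def space_restrict_space)
  have "restart_value M P \<nu> F G \<gamma> x k \<le> restart_value M P \<nu> F G \<gamma> x' k" for k
    using P_kernel nu_prob F_meas F_mono P_mono x by (intro restart_value_mono[where r = r]) (simp_all add: X)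
  \<comment> \<open>The threshold constant does not depend on the state, so it is fixed as
    \<open>C\<close>. The larger value at \<open>x'\<close> enlarges the set of admissible
    \<open>k\<close>, and the infimum in \<open>enat\<close> reverses inclusion, also for an empty
    set.\<close>
  then have "{k. C \<le> G No_Intervention + ennreal \<gamma> * restart_value M P \<nu> F G \<gamma> x (k + 1)}
      \<subseteq> {k. C \<le> G No_Intervention + ennreal \<gamma> * restart_value M P \<nu> F G \<gamma> x' (k + 1)}" for C
    by (auto elim!: order_trans intro!: add_left_mono mult_left_mono)
  then show "threshold_index M P \<nu> F G \<gamma> x' \<le> threshold_index M P \<nu> F G \<gamma> x"
    unfolding threshold_index_def by (intro Inf_superset_mono image_mono)
qed

end
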